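(* Let $f,g,\phi$ satisfy the composite smoothness assumption, and let the saddle-subdifferential operator $M=(\nabla_u\phi+\partial f,\,-\nabla_v\phi+\partial g)$ of the problem $\min_{u}\max_{v}\{f(u)+\phi(u,v)-g(v)\}$ satisfy the strong MVI condition for some $\mu\ge0$. Then, for every $k\ge1$, every $\tau\in\big(0,\frac{1}{L+\hat L}\big)$ and every $x_*\in S_*^\mu(M)$, the sequence $\{x_k\}=\{(u_k,v_k)\}$ of the SA-MGDA method with $J=\infty$ (exact maximization oracle) satisfies $$D_h(x_*,x_k)\le\left(1+\frac{2\tau\mu}{1+\tau L}\right)^{-k}D_h(x_*,x_0).$$
   Context: Let $d=d_u+d_v$, $x=(u,v)\in\mathbb{R}^{d_u}\times\mathbb{R}^{d_v}=\mathbb{R}^d$ with Euclidean inner product and norm. Composite smoothness assumption: $f:\mathbb{R}^{d_u}\to(-\infty,\infty]$ and $g:\mathbb{R}^{d_v}\to(-\infty,\infty]$ are closed, proper and convex; $\phi:\mathbb{R}^d\to\mathbb{R}$ is continuously differentiable and there are $L_{uu},L_{uv},L_{vu},L_{vv}>0$ with $\|\nabla_u\phi(u,v)-\nabla_u\phi(\bar u,\bar v)\|\le L_{uu}\|u-\bar u\|+L_{uv}\|v-\bar v\|$ and $\|\nabla_v\phi(u,v)-\nabla_v\phi(\bar u,\bar v)\|\le L_{vu}\|u-\bar u\|+L_{vv}\|v-\bar v\|$ for all $u,\bar u,v,\bar v$. $L>0$ denotes a Lipschitz constant of $\nabla\phi$ (equivalently of $(\nabla_u\phi,-\nabla_v\phi)$)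 on $\mathbb{R}^d$, and $\hat L=\max\{L_{uu},L_{vv}\}$. $\operatorname{gra}M=\{(x,w):w\in Mx\}$; $X_*(M)=\{x_*:0\in Mx_*\}$ (assumed nonempty). Strong MVI condition with $\mu\ge0$: there exists $x_*\in X_*(M)$ such that $\langle x-x_*,w\rangle\ge\mu\|x-x_*\|^2$ for all $(x,w)\in\operatorname{gra}M$. $S_*^\mu(M)$ is the set of all $x_*\in X_*(M)$ with this property. Let $h(u,v)=\frac{1}{2\tau}(\|u\|^2+\|v\|^2)-\phi(u,v)$ and $D_h(x,y)=h(x)-h(y)-\langle\nabla h(y),x-y\rangle$. SA-MGDA with $J=\infty$: from an initial point $x_0=(u_0,v_0)\in\mathbb{R}^d$, for $k=0,1,\dots$, $u_{k+1}=\operatorname{prox}_{\tau f}[u_k-\tau\nabla_u\phi(u_k,v_k)]$, $v_{k+1}=\operatorname{argmax}_{v\in\mathbb{R}^{d_v}}\big\{2\phi(u_{k+1},v)-\frac1{2\tau}\|v-(v_k-\tau\nabla_v\phi(u_k,v_k))\|^2-g(v)\big\}$, where $\operatorname{prox}_\psi=(I+\partial\psi)^{-1}$. Equivalently, $x_{k+1}=(\nabla h+M)^{-1}\nabla h(x_k)$, i.e. $\nabla h(x_k)-\nabla h(x_{k+1})\in Mx_{k+1}$. *)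

theory Defs
  imports "HOL-Analysis.Analysis"
begin

definition epi :: "('a \<Rightarrow> ereal) \<Rightarrow> ('a \<times> real) set" where
  "epi f = {(x, r). f x \<le> ereal r}"

definition closed_fun :: "('a::topological_space \<Rightarrow> ereal) \<Rightarrow> bool" where
  "closed_fun f \<longleftrightarrow> closed (epi f)"

definition convex_fun :: "('a::real_vector \<Rightarrow> ereal) \<Rightarrow> bool" where
  "convex_fun f \<longleftrightarrow> convex (epi f)"

definition proper_fun :: "('a \<Rightarrow> ereal) \<Rightarrow> bool" where
  "proper_fun f \<longleftrightarrow> (\<forall>x. f x \<noteq> -\<infinity>) \<and> (\<exists>x. f x \<noteq> \<infinity>)"

text \<open>For proper \<open>f\<close>, the subdifferential is automatically empty at every point where \<open>f = \<infinity>\<close>.\<close>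

definition subdiff :: "('a::real_inner \<Rightarrow> ereal) \<Rightarrow> 'a \<Rightarrow> 'a set" where
  "subdiff f x = {s. \<forall>y. f x + ereal (inner s (y - x)) \<le> f y}"

text \<open>The set-valued map \<open>(I + \<partial>\<psi>)\<inverse>\<close>, single-valued for closed proper convex \<open>\<psi>\<close>.\<close>

definition prox :: "('a::real_inner \<Rightarrow> ereal) \<Rightarrow> 'a \<Rightarrow> 'a set" where
  "prox \<psi> x = {y. \<exists>s \<in> subdiff \<psi> y. x = y + s}"

definition grad :: "('a::real_inner \<Rightarrow> real) \<Rightarrow> 'a \<Rightarrow> 'a" where
  "grad F x = (THE D. GDERIV F x :> D)"

definition grad_u :: "('a::real_inner \<times> 'b \<Rightarrow> real) \<Rightarrow> 'a \<Rightarrow> 'b \<Rightarrow> 'a" where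
  "grad_u \<phi> u v = grad (\<lambda>u'. \<phi> (u', v)) u"

definition grad_v :: "('a \<times> 'b::real_inner \<Rightarrow> real) \<Rightarrow> 'a \<Rightarrow> 'b \<Rightarrow> 'b" where
  "grad_v \<phi> u v = grad (\<lambda>v'. \<phi> (u, v')) v"

definition bregman :: "('a::real_inner \<Rightarrow> real) \<Rightarrow> 'a \<Rightarrow> 'a \<Rightarrow> real" where
  "bregman h x y = h x - h y - inner (grad h y) (x - y)"

definition h_fun ::
  "('a::real_inner \<times> 'b::real_inner \<Rightarrow> real) \<Rightarrow> real \<Rightarrow> 'a \<times> 'b \<Rightarrow> real" where
  "h_fun \<phi> \<tau> = (\<lambda>(u, v). 1 / (2 * \<tau>) * ((norm u)\<^sup>2 + (norm v)\<^sup>2) - \<phi> (u, v))"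

definition gra :: "('a \<Rightarrow> 'a set) \<Rightarrow> ('a \<times> 'a) set" where
  "gra M = {(x, w). w \<in> M x}"

definition zer :: "('a::zero \<Rightarrow> 'a set) \<Rightarrow> 'a set" where
  "zer M = {x. 0 \<in> M x}"

definition S_star :: "real \<Rightarrow> ('a::real_inner \<Rightarrow> 'a set) \<Rightarrow> 'a set" where
  "S_star \<mu> M =
     {xs \<in> zer M. \<forall>(x, w) \<in> gra M. inner (x - xs) w \<ge> \<mu> * (norm (x - xs))\<^sup>2}"

definition strong_MVI :: "real \<Rightarrow> ('a::real_inner \<Rightarrow> 'a set) \<Rightarrow> bool" where
  "strong_MVI \<mu> M \<longleftrightarrow>
     (\<exists>xs \<in> zer M. \<forall>(x, w) \<in> gra M. inner (x - xs) w \<ge> \<mu> * (norm (x - xs))\<^sup>2)"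

definition composite_smooth ::
  "('a::euclidean_space \<Rightarrow> ereal) \<Rightarrow> ('b::euclidean_space \<Rightarrow> ereal) \<Rightarrow> ('a \<times> 'b \<Rightarrow> real)
    \<Rightarrow> real \<Rightarrow> real \<Rightarrow> real \<Rightarrow> real \<Rightarrow> bool" where
  "composite_smooth f g \<phi> Luu Luv Lvu Lvv \<longleftrightarrow>
     closed_fun f \<and> proper_fun f \<and> convex_fun f \<and>
     closed_fun g \<and> proper_fun g \<and> convex_fun g \<and>
     \<phi> differentiable_on UNIV \<and> continuous_on UNIV (grad \<phi>) \<and>
     0 < Luu \<and> 0 < Luv \<and> 0 < Lvu \<and> 0 < Lvv \<and>
     (\<forall>u u' v v'. norm (grad_u \<phi> u v - grad_u \<phi> u' v')
                    \<le> Luu * norm (u - u') + Luv * norm (v - v')) \<and>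
     (\<forall>u u' v v'. norm (grad_v \<phi> u v - grad_v \<phi> u' v')
                    \<le> Lvu * norm (u - u') + Lvv * norm (v - v'))"

definition saddle_subdiff ::
  "('a::real_inner \<Rightarrow> ereal) \<Rightarrow> ('b::real_inner \<Rightarrow> ereal) \<Rightarrow> ('a \<times> 'b \<Rightarrow> real)
    \<Rightarrow> 'a \<times> 'b \<Rightarrow> ('a \<times> 'b) set" where
  "saddle_subdiff f g \<phi> =
     (\<lambda>(u, v). {(grad_u \<phi> u v + \<xi>, - grad_v \<phi> u v + \<eta>) | \<xi> \<eta>.
                   \<xi> \<in> subdiff f u \<and> \<eta> \<in> subdiff g v})"

text \<open>SA-MGDA with \<open>J = \<infinity>\<close>: the \<open>v\<close>-update is an exact maximizer. The starting point
  \<open>(u 0, v 0)\<close> is arbitrary, so \<open>f\<close> or \<open>g\<close> may be infinite there.\<close>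

definition sa_mgda_inf ::
  "('a::real_inner \<Rightarrow> ereal) \<Rightarrow> ('b::real_inner \<Rightarrow> ereal) \<Rightarrow> ('a \<times> 'b \<Rightarrow> real) \<Rightarrow> real
    \<Rightarrow> (nat \<Rightarrow> 'a) \<Rightarrow> (nat \<Rightarrow> 'b) \<Rightarrow> bool" where
  "sa_mgda_inf f g \<phi> \<tau> u v \<longleftrightarrow>
     (\<forall>k. u (Suc k) \<in> prox (\<lambda>y. ereal \<tau> * f y) (u k - \<tau> *\<^sub>R grad_u \<phi> (u k) (v k)) \<and>
          is_arg_max
            (\<lambda>w. ereal (2 * \<phi> (u (Suc k), w)
                    - 1 / (2 * \<tau>) * (norm (w - (v k - \<tau> *\<^sub>R grad_v \<phi> (u k) (v k))))\<^sup>2) - g w)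
            (\<lambda>w. True) (v (Suc k)))"

end

theory Submission
  imports Defs
begin

text \<open>With \<open>J = \<infinity>\<close> the method is a Bregman proximal point method: the optimality conditions of
  the two subproblems at step \<open>k\<close> say together that \<open>\<nabla>h x\<^sub>k - \<nabla>h x\<^sub>k\<^sub>+\<^sub>1\<close> belongs to \<open>M x\<^sub>k\<^sub>+\<^sub>1\<close>
  (\<open>sa_mgda_inf_step_in_saddle_subdiff\<close>). The term \<open>-\<phi>\<close> in \<open>h\<close> turns the gradients taken at the old
  point into gradients at the new one.

  The three-point identity expands \<open>D\<^sub>h(x\<^sub>*, x\<^sub>k)\<close> as
  \<open>D\<^sub>h(x\<^sub>*, x\<^sub>k\<^sub>+\<^sub>1) + D\<^sub>h(x\<^sub>k\<^sub>+\<^sub>1, x\<^sub>k) + \<langle>\<nabla>h x\<^sub>k - \<nabla>h x\<^sub>k\<^sub>+\<^sub>1, x\<^sub>k\<^sub>+\<^sub>1 - x\<^sub>*\<rangle>\<close>.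
  The last term is at least \<open>\<mu> \<parallel>x\<^sub>k\<^sub>+\<^sub>1 - x\<^sub>*\<parallel>\<^sup>2\<close> by the strong MVI condition. Since \<open>\<nabla>\<phi>\<close> is
  \<open>L\<close>-Lipschitz, \<open>D\<^sub>h(x, y)\<close> lies between the multiples \<open>(1 \<mp> \<tau>L)/(2\<tau>)\<close> of \<open>\<parallel>x - y\<parallel>\<^sup>2\<close>. The
  lower bound and \<open>\<tau>L < 1\<close> allow the middle term to be dropped; the upper bound turns the MVI term into
  a multiple \<open>2\<tau>\<mu>/(1 + \<tau>L)\<close> of \<open>D\<^sub>h(x\<^sub>*, x\<^sub>k\<^sub>+\<^sub>1)\<close>. Hence every step contracts the Bregman distance
  to \<open>x\<^sub>*\<close> by the claimed factor (\<open>bregman_proximal_step_contraction\<close>).\<close>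

section \<open>Gradients and the descent lemma\<close>

lemma grad_eqI:
  assumes "GDERIV F x :> D"
  shows "grad F x = D"
  unfolding grad_def
proof (rule the_equality)
  fix D' assume "GDERIV F x :> D'"
  then have "(\<lambda>h. inner h D') = (\<lambda>h. inner h D)"
    using assms unfolding gderiv_def by (rule has_derivative_unique)
  then have "inner (D' - D) D' = inner (D' - D) D"
    by (rule fun_cong)
  then have "inner (D' - D) (D' - D) = 0"
    by (simp add: inner_diff_right)
  then show "D' = D" by simp
qed (fact assms)

lemma GDERIV_grad:
  fixes F :: "'a::euclidean_space \<Rightarrow> real"
  assumes "F differentiable (at x)"
  shows "GDERIV F x :> grad F x"
proof -
  obtain F' where F': "(F has_derivative F') (at x)"
    using assms by (auto simp: differentiable_def)
  then have "linear F'" by (rule has_derivative_linear)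
  then have "F' = (\<lambda>h. inner h (adjoint F' 1))"
    by (simp add: fun_eq_iff adjoint_works)
  with F' have "GDERIV F x :> adjoint F' 1"
    unfolding gderiv_def by metis
  then show ?thesis
    using grad_eqI by metis
qed

lemma grad_u_eq_fst_grad:
  fixes \<phi> :: "'a::euclidean_space \<times> 'b::euclidean_space \<Rightarrow> real"
  assumes "\<phi> differentiable (at (u, v))"
  shows "grad_u \<phi> u v = fst (grad \<phi> (u, v))"
  unfolding grad_u_def
proof (rule grad_eqI)
  have "((\<lambda>u'. (u', v)) has_derivative (\<lambda>h. (h, 0))) (at u)"
    by (auto intro!: derivative_eq_intros)
  from diff_chain_at[OF this GDERIV_grad[OF assms, unfolded gderiv_def]]
  show "GDERIV (\<lambda>u'. \<phi> (u', v)) u :> fst (grad \<phi> (u, v))"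
    by (simp add: gderiv_def o_def inner_prod_def)
qed

lemma GDERIV_partial_snd:
  fixes \<phi> :: "'a::euclidean_space \<times> 'b::euclidean_space \<Rightarrow> real"
  assumes "\<phi> differentiable (at (u, v))"
  shows "GDERIV (\<lambda>v'. \<phi> (u, v')) v :> snd (grad \<phi> (u, v))"
proof -
  have "((\<lambda>v'. (u, v')) has_derivative (\<lambda>h. (0, h))) (at v)"
    by (auto intro!: derivative_eq_intros)
  from diff_chain_at[OF this GDERIV_grad[OF assms, unfolded gderiv_def]]
  show ?thesis
    by (simp add: gderiv_def o_def inner_prod_def)
qed

text \<open>The descent lemma, for a gradient that is Lipschitz: along the segment from \<open>y\<close> to \<open>x\<close> the
  derivative of \<open>F\<close> exceeds its initial value by at most \<open>L t \<parallel>x - y\<parallel>\<^sup>2\<close>, so subtracting the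
  corresponding quadratic leaves a nonincreasing function.\<close>

lemma lipschitz_gradient_upper_bound:
  fixes F :: "'a::real_inner \<Rightarrow> real"
  assumes deriv: "\<And>x. GDERIV F x :> G x" and lip: "L-lipschitz_on UNIV G"
  shows "F x - F y - inner (G y) (x - y) \<le> L / 2 * (norm (x - y))\<^sup>2"
proof -
  define d where "d = x - y"
  define q where "q t = F (y + t *\<^sub>R d) - t * inner (G y) d - L / 2 * t\<^sup>2 * (norm d)\<^sup>2" for t :: real
  have "q 1 \<le> q 0"
  proof (rule DERIV_nonpos_imp_nonincreasing[of 0 1 q])
    fix t :: real assume t: "0 \<le> t" "t \<le> 1"
    let ?m = "inner (G (y + t *\<^sub>R d) - G y) d - L * t * (norm d)\<^sup>2"
    have seg: "((\<lambda>t. y + t *\<^sub>R d) has_derivative (\<lambda>s. s *\<^sub>R d)) (at t)"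
      by (auto intro!: derivative_eq_intros)
    have "((\<lambda>t. F (y + t *\<^sub>R d)) has_derivative (\<lambda>s. inner (s *\<^sub>R d) (G (y + t *\<^sub>R d)))) (at t)"
      using diff_chain_at[OF seg deriv[unfolded gderiv_def]] by (simp add: o_def)
    then have "((\<lambda>t. F (y + t *\<^sub>R d)) has_real_derivative inner (G (y + t *\<^sub>R d)) d) (at t)"
      by (simp add: has_field_derivative_def inner_commute mult.commute[of _ "inner _ _"])
    then have "(q has_real_derivative ?m) (at t)"
      unfolding q_def by (auto intro!: derivative_eq_intros simp: inner_diff_left)
    moreover have "inner (G (y + t *\<^sub>R d) - G y) d \<le> L * t * (norm d)\<^sup>2"
    proof -
      have "norm (G (y + t *\<^sub>R d) - G y) \<le> L * (t * norm d)"
        using lipschitz_onD[OF lip, of "y + t *\<^sub>R d" y] t by (simp add: dist_norm)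
      then have "norm (G (y + t *\<^sub>R d) - G y) * norm d \<le> L * (t * norm d) * norm d"
        by (rule mult_right_mono) simp
      then show ?thesis
        using norm_cauchy_schwarz[of "G (y + t *\<^sub>R d) - G y" d] by (simp add: power2_eq_square mult.assoc)
    qed
    ultimately show "\<exists>m. (q has_real_derivative m) (at t) \<and> m \<le> 0"
      by (auto intro!: exI[of _ ?m])
  qed simp
  then show ?thesis by (simp add: q_def d_def)
qed

lemma lipschitz_gradient_abs_bound:
  fixes F :: "'a::real_inner \<Rightarrow> real"
  assumes deriv: "\<And>x. GDERIV F x :> G x" and lip: "L-lipschitz_on UNIV G"
  shows "\<bar>F x - F y - inner (G y) (x - y)\<bar> \<le> L / 2 * (norm (x - y))\<^sup>2"
proof -
  have "GDERIV (\<lambda>x. - F x) x :> - G x" for x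
    using deriv by (rule GDERIV_minus)
  moreover have "L-lipschitz_on UNIV (\<lambda>x. - G x)"
    using lip by simp
  ultimately have "- F x - - F y - inner (- G y) (x - y) \<le> L / 2 * (norm (x - y))\<^sup>2"
    by (rule lipschitz_gradient_upper_bound)
  then show ?thesis
    using lipschitz_gradient_upper_bound[OF deriv lip, of x y] unfolding inner_minus_left by linarith
qed

section \<open>Subgradients from optimality conditions\<close>

text \<open>Scaling a function scales its subgradients, so a proximal step on \<open>\<tau> f\<close> produces a
  subgradient of \<open>f\<close> itself.\<close>

lemma prox_scaled_subgradient:
  fixes f :: "'a::real_inner \<Rightarrow> ereal"
  assumes "0 < \<tau>" and "y \<in> prox (\<lambda>z. ereal \<tau> * f z) x"
  shows "(1 / \<tau>) *\<^sub>R (x - y) \<in> subdiff f y"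
proof -
  have sub: "ereal \<tau> * f y + ereal (inner (x - y) (z - y)) \<le> ereal \<tau> * f z" for z
    using assms(2) by (auto simp: prox_def subdiff_def)
  have "f y + ereal (inner ((1 / \<tau>) *\<^sub>R (x - y)) (z - y)) \<le> f z" for z
    using sub[of z] \<open>0 < \<tau>\<close> unfolding inner_scaleR_left
    by (cases "f y"; cases "f z") (auto simp: field_simps)
  then show ?thesis by (simp add: subdiff_def)
qed

lemma convex_fun_segment_le:
  assumes "convex_fun g" "g x = ereal a" "g y = ereal b" "0 \<le> t" "t \<le> 1"
  shows "g (x + t *\<^sub>R (y - x)) \<le> ereal (a + t * (b - a))"
proof -
  have "(1 - t) *\<^sub>R (x, a) + t *\<^sub>R (y, b) \<in> epi g"
    using assms by (intro convexD[of "epi g"]) (auto simp: convex_fun_def epi_def)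
  then show ?thesis
    by (simp add: epi_def algebra_simps)
qed

text \<open>Fermat's rule. Moving a fraction \<open>t\<close> of the way from \<open>v\<close> to \<open>y\<close> raises \<open>g\<close> by at most
  \<open>t (g y - g v)\<close>, by convexity, and so raises \<open>\<psi>\<close> by no more than that, by maximality; dividing
  by \<open>t\<close> and letting \<open>t\<close> tend to \<open>0\<close> gives the subgradient inequality.\<close>

lemma arg_max_gradient_in_subdiff:
  fixes \<psi> :: "'b::real_inner \<Rightarrow> real" and g :: "'b \<Rightarrow> ereal"
  assumes "convex_fun g" "proper_fun g" and deriv: "GDERIV \<psi> v :> D"
    and max: "is_arg_max (\<lambda>w. ereal (\<psi> w) - g w) (\<lambda>w. True) v"
  shows "D \<in> subdiff g v"
proof -
  have le: "ereal (\<psi> w) - g w \<le> ereal (\<psi> v) - g v" for w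
    using max by (auto simp: is_arg_max_def not_less)
  have not_minf: "g w \<noteq> -\<infinity>" for w
    using \<open>proper_fun g\<close> by (simp add: proper_fun_def)
  \<comment> \<open>\<open>g\<close> is finite at the maximizer: otherwise any point of its domain would give a larger value.\<close>
  obtain w0 where "g w0 \<noteq> \<infinity>"
    using \<open>proper_fun g\<close> by (auto simp: proper_fun_def)
  with le[of w0] not_minf[of w0] not_minf[of v] obtain a where a: "g v = ereal a"
    by (cases "g v"; cases "g w0") auto
  have "g v + ereal (inner D (y - v)) \<le> g y" for y
  proof (cases "g y")
    case (real b)
    let ?d = "y - v"
    have quot: "(\<psi> (v + t *\<^sub>R ?d) - \<psi> v) / t \<le> b - a" if "0 < t" "t < 1" for t
    proof -
      have "g (v + t *\<^sub>R ?d) \<le> ereal (a + t * (b - a))"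
        using convex_fun_segment_le[OF \<open>convex_fun g\<close> a real] that by simp
      then have "\<psi> (v + t *\<^sub>R ?d) - \<psi> v \<le> t * (b - a)"
        using le[of "v + t *\<^sub>R ?d"] not_minf[of "v + t *\<^sub>R ?d"] a
        by (cases "g (v + t *\<^sub>R ?d)") auto
      with that show ?thesis by (simp add: field_simps)
    qed
    have "((\<lambda>t. v + t *\<^sub>R ?d) has_derivative (\<lambda>s. s *\<^sub>R ?d)) (at 0)"
      by (auto intro!: derivative_eq_intros)
    moreover have "(\<psi> has_derivative (\<lambda>h. inner h D)) (at (v + 0 *\<^sub>R ?d))"
      using deriv by (simp add: gderiv_def)
    ultimately have "((\<lambda>t. \<psi> (v + t *\<^sub>R ?d)) has_derivative (\<lambda>s. inner (s *\<^sub>R ?d) D)) (at 0)"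
      using diff_chain_at by (fastforce simp: o_def)
    then have "((\<lambda>t. \<psi> (v + t *\<^sub>R ?d)) has_real_derivative inner D ?d) (at 0)"
      by (simp add: has_field_derivative_def inner_commute mult.commute[of _ "inner _ _"])
    then have "((\<lambda>t. (\<psi> (v + t *\<^sub>R ?d) - \<psi> v) / t) \<longlongrightarrow> inner D ?d) (at 0)"
      by (simp add: DERIV_def)
    then have lim: "((\<lambda>t. (\<psi> (v + t *\<^sub>R ?d) - \<psi> v) / t) \<longlongrightarrow> inner D ?d) (at_right 0)"
      by (rule tendsto_mono[rotated]) (simp add: at_le)
    have "\<forall>\<^sub>F t in at_right 0. (\<psi> (v + t *\<^sub>R ?d) - \<psi> v) / t \<le> b - a"
      using quot by (auto simp: eventually_at_right_field intro!: exI[of _ 1])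
    with lim have "inner D ?d \<le> b - a"
      by (rule tendsto_upperbound) simp
    with a real show ?thesis by simp
  qed (use not_minf in auto)
  then show ?thesis by (simp add: subdiff_def)
qed

section \<open>Bregman proximal steps\<close>

lemma bregman_three_point:
  "bregman h z x = bregman h z y + bregman h y x + inner (grad h x - grad h y) (y - z)"
  by (simp add: bregman_def algebra_simps inner_diff_left inner_diff_right)

text \<open>The upper bound on \<open>bregman h xs y\<close> is what converts the quadratic gain from the strong MVI
  condition into a gain in the Bregman distance.\<close>

lemma bregman_proximal_step_contraction:
  assumes step: "grad h x - grad h y \<in> M y" and xs: "xs \<in> S_star \<mu> M" and "0 \<le> \<mu>" "0 < \<beta>"
    and nonneg: "0 \<le> bregman h y x"
    and upper: "bregman h xs y \<le> \<beta> / 2 * (norm (xs - y))\<^sup>2"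
  shows "(1 + 2 * \<mu> / \<beta>) * bregman h xs y \<le> bregman h xs x"
proof -
  have "\<mu> * (norm (y - xs))\<^sup>2 \<le> inner (grad h x - grad h y) (y - xs)"
    using xs step by (auto simp: S_star_def gra_def inner_commute[of _ "y - xs"])
  moreover have "2 * \<mu> / \<beta> * bregman h xs y \<le> 2 * \<mu> / \<beta> * (\<beta> / 2 * (norm (xs - y))\<^sup>2)"
    using upper \<open>0 \<le> \<mu>\<close> \<open>0 < \<beta>\<close> by (intro mult_left_mono) auto
  moreover have "2 * \<mu> / \<beta> * (\<beta> / 2 * (norm (xs - y))\<^sup>2) = \<mu> * (norm (y - xs))\<^sup>2"
    using \<open>0 < \<beta>\<close> by (simp add: norm_minus_commute)
  ultimately show ?thesis
    using nonneg bregman_three_point[of h xs x y] unfolding distrib_right mult_1_left by linarith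
qed

section \<open>SA-MGDA as a Bregman proximal point method\<close>

lemma h_fun_eq: "h_fun \<phi> \<tau> x = 1 / (2 * \<tau>) * inner x x - \<phi> x"
  by (cases x) (simp add: h_fun_def inner_prod_def power2_norm_eq_inner)

lemma grad_h_fun:
  fixes \<phi> :: "'a::euclidean_space \<times> 'b::euclidean_space \<Rightarrow> real"
  assumes "\<phi> differentiable (at x)" "0 < \<tau>"
  shows "grad (h_fun \<phi> \<tau>) x = (1 / \<tau>) *\<^sub>R x - grad \<phi> x"
proof (rule grad_eqI)
  have "GDERIV (\<lambda>x. 1 / (2 * \<tau>) * inner x x - \<phi> x) x :> (1 / \<tau>) *\<^sub>R x - grad \<phi> x"
    using GDERIV_grad[OF assms(1)] \<open>0 < \<tau>\<close> unfolding gderiv_def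
    by (auto intro!: derivative_eq_intros simp: fun_eq_iff inner_diff_right inner_commute field_simps)
  then show "GDERIV (h_fun \<phi> \<tau>) x :> (1 / \<tau>) *\<^sub>R x - grad \<phi> x"
    by (simp add: h_fun_eq[abs_def])
qed

lemma bregman_h_fun:
  fixes \<phi> :: "'a::euclidean_space \<times> 'b::euclidean_space \<Rightarrow> real"
  assumes "\<phi> differentiable (at y)" "0 < \<tau>"
  shows "bregman (h_fun \<phi> \<tau>) x y
    = 1 / (2 * \<tau>) * (norm (x - y))\<^sup>2 - (\<phi> x - \<phi> y - inner (grad \<phi> y) (x - y))"
proof -
  have expand: "inner x x = inner y y + 2 * inner y (x - y) + (norm (x - y))\<^sup>2"
    by (simp add: power2_norm_eq_inner inner_diff_left inner_diff_right inner_commute)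
  then show ?thesis
    using \<open>0 < \<tau>\<close> unfolding bregman_def grad_h_fun[OF assms] h_fun_eq expand inner_diff_left
    by (simp add: field_simps)
qed

text \<open>The Bregman proximal form of the iteration. The \<open>v\<close>-subproblem maximizes \<open>2\<phi>\<close> minus the
  quadratic; its optimality condition spends one copy of \<open>\<nabla>\<^sub>v\<phi>\<close> at the new point on \<open>\<nabla>h\<close> and the
  other on \<open>M\<close>.\<close>

lemma sa_mgda_inf_step_in_saddle_subdiff:
  fixes \<phi> :: "'a::euclidean_space \<times> 'b::euclidean_space \<Rightarrow> real"
  assumes diff: "\<And>x. \<phi> differentiable (at x)" and "0 < \<tau>"
    and g: "convex_fun g" "proper_fun g" and alg: "sa_mgda_inf f g \<phi> \<tau> u v"
  shows "grad (h_fun \<phi> \<tau>) (u k, v k) - grad (h_fun \<phi> \<tau>) (u (Suc k), v (Suc k))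
           \<in> saddle_subdiff f g \<phi> (u (Suc k), v (Suc k))"
proof -
  let ?u = "u (Suc k)" and ?v = "v (Suc k)"
  define c where "c = v k - \<tau> *\<^sub>R grad_v \<phi> (u k) (v k)"
  define \<xi> where "\<xi> = (1 / \<tau>) *\<^sub>R (u k - \<tau> *\<^sub>R grad_u \<phi> (u k) (v k) - ?u)"
  define \<eta> where "\<eta> = 2 *\<^sub>R snd (grad \<phi> (?u, ?v)) - (1 / \<tau>) *\<^sub>R (?v - c)"
  have \<xi>: "\<xi> \<in> subdiff f ?u"
    unfolding \<xi>_def using alg \<open>0 < \<tau>\<close>
    by (intro prox_scaled_subgradient) (auto simp: sa_mgda_inf_def)
  have gv: "grad_v \<phi> a b = snd (grad \<phi> (a, b))" for a b
    unfolding grad_v_def by (intro grad_eqI GDERIV_partial_snd diff)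
  have "GDERIV (\<lambda>w. 2 * \<phi> (?u, w) - 1 / (2 * \<tau>) * (norm (w - c))\<^sup>2) ?v :> \<eta>"
    using GDERIV_partial_snd[OF diff, of ?u ?v] \<open>0 < \<tau>\<close>
    unfolding gderiv_def \<eta>_def power2_norm_eq_inner
    by (auto intro!: derivative_eq_intros simp: fun_eq_iff inner_diff_right inner_diff_left inner_add_right inner_commute field_simps)
  moreover have "is_arg_max (\<lambda>w. ereal (2 * \<phi> (?u, w) - 1 / (2 * \<tau>) * (norm (w - c))\<^sup>2) - g w)
      (\<lambda>w. True) ?v"
    using alg by (simp add: sa_mgda_inf_def c_def)
  ultimately have \<eta>: "\<eta> \<in> subdiff g ?v"
    by (rule arg_max_gradient_in_subdiff[OF g])
  have "grad (h_fun \<phi> \<tau>) (u k, v k) - grad (h_fun \<phi> \<tau>) (?u, ?v)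
      = (grad_u \<phi> ?u ?v + \<xi>, - grad_v \<phi> ?u ?v + \<eta>)"
    using \<open>0 < \<tau>\<close>
    by (simp add: prod_eq_iff grad_h_fun diff grad_u_eq_fst_grad gv \<xi>_def \<eta>_def c_def
        algebra_simps scaleR_2)
  with \<xi> \<eta> show ?thesis
    by (auto simp: saddle_subdiff_def)
qed

theorem theorem5p3:
  fixes f :: "'a::euclidean_space \<Rightarrow> ereal"
    and g :: "'b::euclidean_space \<Rightarrow> ereal"
    and \<phi> :: "'a \<times> 'b \<Rightarrow> real"
    and u :: "nat \<Rightarrow> 'a" and v :: "nat \<Rightarrow> 'b"
    and Luu Luv Lvu Lvv L \<mu> \<tau> :: real
    and xs :: "'a \<times> 'b" and k :: nat
  assumes "composite_smooth f g \<phi> Luu Luv Lvu Lvv"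
    and "0 < L" and "L-lipschitz_on UNIV (grad \<phi>)"
    and "0 \<le> \<mu>" and "strong_MVI \<mu> (saddle_subdiff f g \<phi>)"
    and "1 \<le> k"
    and "\<tau> \<in> {0 <..< 1 / (L + max Luu Lvv)}"
    and "xs \<in> S_star \<mu> (saddle_subdiff f g \<phi>)"
    and "sa_mgda_inf f g \<phi> \<tau> u v"
  shows "bregman (h_fun \<phi> \<tau>) xs (u k, v k)
           \<le> (1 + 2 * \<tau> * \<mu> / (1 + \<tau> * L)) powi (- int k)
              * bregman (h_fun \<phi> \<tau>) xs (u 0, v 0)"
proof -
  let ?h = "h_fun \<phi> \<tau>" and ?q = "1 + 2 * \<tau> * \<mu> / (1 + \<tau> * L)"
  have diff: "\<phi> differentiable (at x)" for x
    using assms(1) unfolding composite_smooth_def differentiable_on_def by (simp del: split_paired_All)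
  have g: "convex_fun g" "proper_fun g" and Luu: "0 < Luu"
    using assms(1) by (auto simp: composite_smooth_def)
  have "0 < \<tau>"
    using assms(7) by simp
  have "\<tau> * L < 1"
  proof -
    have "\<tau> * (L + max Luu Lvv) < 1"
      using assms(2,7) Luu by (simp add: pos_less_divide_eq)
    moreover have "0 < \<tau> * max Luu Lvv"
      using \<open>0 < \<tau>\<close> Luu by simp
    ultimately show ?thesis by (simp add: distrib_left)
  qed
  have pos: "0 < 1 + \<tau> * L"
    using \<open>0 < \<tau>\<close> \<open>0 < L\<close> by (simp add: add_pos_pos)
  note bound = lipschitz_gradient_abs_bound[OF GDERIV_grad[OF diff] assms(3)]
  have lower: "0 \<le> bregman ?h x y" for x y
  proof -
    have "L / 2 * (norm (x - y))\<^sup>2 \<le> 1 / (2 * \<tau>) * (norm (x - y))\<^sup>2"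
      using \<open>0 < \<tau>\<close> \<open>\<tau> * L < 1\<close> by (intro mult_right_mono) (auto simp: field_simps)
    then show ?thesis
      unfolding bregman_h_fun[OF diff \<open>0 < \<tau>\<close>] using bound[of x y] by linarith
  qed
  have upper: "bregman ?h x y \<le> (1 + \<tau> * L) / \<tau> / 2 * (norm (x - y))\<^sup>2" for x y
  proof -
    have "(1 + \<tau> * L) / \<tau> / 2 * (norm (x - y))\<^sup>2
        = 1 / (2 * \<tau>) * (norm (x - y))\<^sup>2 + L / 2 * (norm (x - y))\<^sup>2"
      using \<open>0 < \<tau>\<close> by (simp add: field_simps)
    then show ?thesis
      unfolding bregman_h_fun[OF diff \<open>0 < \<tau>\<close>] using bound[of x y] by linarith
  qed
  have step: "?q * bregman ?h xs (u (Suc j), v (Suc j)) \<le> bregman ?h xs (u j, v j)" for j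
    using bregman_proximal_step_contraction
      [OF sa_mgda_inf_step_in_saddle_subdiff[OF diff \<open>0 < \<tau>\<close> g assms(9)] assms(8,4) _ lower upper]
      \<open>0 < \<tau>\<close> pos by (simp add: mult_ac)
  have "1 \<le> ?q"
    using \<open>0 < \<tau>\<close> pos \<open>0 \<le> \<mu>\<close> by simp
  have "?q ^ k * bregman ?h xs (u k, v k) \<le> bregman ?h xs (u 0, v 0)"
  proof (induction k)
    case (Suc k)
    have "?q ^ k * (?q * bregman ?h xs (u (Suc k), v (Suc k))) \<le> ?q ^ k * bregman ?h xs (u k, v k)"
      using step \<open>1 \<le> ?q\<close> by (intro mult_left_mono) auto
    with Suc show ?case by (simp add: mult_ac)
  qed simp
  moreover have "0 < ?q ^ k"
    using \<open>1 \<le> ?q\<close> by (intro zero_less_power) linarith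
  moreover have "?q powi (- int k) = inverse (?q ^ k)"
    by (simp add: power_int_minus)
  ultimately show ?thesis
    by (simp add: field_simps)
qed

end
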